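(* Fix $n,m\in\mathbb{N}$ and $q\in\mathbb{R}_{>0}$. For every (possibly randomized) allocation policy $\mathcal{A}$ and every request sequence $E\in\mathcal{E}_{n,m,q}$, there exists a nested request sequence $E'\in\mathcal{E}^{\textsc{nest}}_{n,m,q}$ such that $$\textsc{WF}(E)\preceq \mathbb{E}[\mathcal{A}(E')]\qquad\text{and}\qquad \textsc{OPT}(E)\succeq \textsc{OPT}(E'),$$ where the expectation is over the internal randomness of $\mathcal{A}$.
   Context: Offline nodes are $[n]=\{1,\dots,n\}$. A request sequence is $E=((N_t,q_t))_{t\in[m]}$: online node $t$ arrives at time $t$ with a nonempty neighborhood $N_t\subseteq[n]$ and a divisible quantity $q_t>0$. $\mathcal{E}_{n,m,q}$ is the set of request sequences with $n$ offline nodes, $m$ online nodes and $\sum_t q_t=q$; $\mathcal{E}^{\textsc{nest}}_{n,m,q}\subseteq\mathcal{E}_{n,m,q}$ is the set of nested ones, i.e. with $N_1\supseteq N_2\supseteq\cdots\supseteq N_m$. For $N\subseteq[n]$, $q>0$ let $\Delta(N,q)=\{x\in\mathbb{R}^n_{\ge0}: x(i)=0\ \forall i\notin N,\ \sum_i x(i)=q\}$, and let $\Delta(E)=\Delta(N_1,q_1)+\cdots+\Delta(N_m,q_m)$ (Minkowski sum), the set of feasible load vectors. An allocation policy $\mathcal{A}$, upon arrival of node $t$, chooses $x_t\in\Delta(N_t,q_t)$ as a function of $(N_1,q_1),\dots,(N_t,q_t)$, of $x_1,\dots,x_{t-1}$, and (if randomized) of its internal randomness; $\mathcal{A}(E)=\sum_t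 x_t$. The sequence $E$ is fixed in advance (it does not depend on the realization of $\mathcal{A}$'s randomness). Majorization: for $x,y\in\mathbb{R}^n_{\ge0}$ with equal coordinate sums, $x\succeq y$ ($x$ majorizes $y$, also written $y\preceq x$) iff for every $j\in[n]$ the sum of the $j$ largest entries of $x$ is at least the sum of the $j$ largest entries of $y$; $x\sim y$ iff $x\succeq y$ and $y\succeq x$. It is known that $\Delta(E)$ contains a unique element $\textsc{OPT}(E)$ with $\textsc{OPT}(E)\preceq \ell$ for all $\ell\in\Delta(E)$. Water-filling ($\textsc{WF}$) is the deterministic policy which, given current loads $\ell_{t-1}=\sum_{s<t}x_s$ ($\ell_0=0$), chooses $x_t\in\Delta(N_t,q_t)$ maximizing $\min_{i\in N_t}(x_t(i)+\ell_{t-1}(i))$ (this maximizer is unique); $\textsc{WF}(E)$ is its final load vector. *)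

theory Defs
  imports "HOL-Probability.Probability" "HOL-Library.Set_Algebras"
begin

text \<open>
  The offline nodes are the elements of a finite type \<open>'n\<close>, so \<open>n = CARD('n)\<close>; load vectors are
  elements of \<open>real ^ 'n\<close>. A request is a neighborhood together with a quantity, and a request
  sequence is the list of requests in order of arrival.
\<close>

type_synonym 'n request = "'n set \<times> real"

definition request_seq :: "'n request list \<Rightarrow> bool" where
  "request_seq E \<longleftrightarrow> (\<forall>(N, r) \<in> set E. N \<noteq> {} \<and> 0 < r)"

definition request_seqs :: "nat \<Rightarrow> real \<Rightarrow> 'n request list set" where
  "request_seqs m q = {E. request_seq E \<and> length E = m \<and> sum_list (map snd E) = q}"

definition nested_request_seqs :: "nat \<Rightarrow> real \<Rightarrow> 'n request list set" where
  "nested_request_seqs m q = {E \<in> request_seqs m q. sorted_wrt (\<supseteq>) (map fst E)}"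

definition allocs :: "'n::finite set \<Rightarrow> real \<Rightarrow> (real ^ 'n) set" where
  "allocs N r = {x. (\<forall>i. 0 \<le> x $ i) \<and> (\<forall>i. i \<notin> N \<longrightarrow> x $ i = 0) \<and> (\<Sum>i\<in>UNIV. x $ i) = r}"

text \<open>The sum below is the Minkowski sum of sets.\<close>

definition feasible_loads :: "'n::finite request list \<Rightarrow> (real ^ 'n) set" where
  "feasible_loads E = sum_list (map (\<lambda>(N, r). allocs N r) E)"

definition sum_largest :: "nat \<Rightarrow> real ^ 'n::finite \<Rightarrow> real" where
  "sum_largest j x =
     sum_list (take j (rev (sorted_list_of_multiset (image_mset (($) x) (mset_set UNIV)))))"

definition majorizes :: "real ^ 'n::finite \<Rightarrow> real ^ 'n \<Rightarrow> bool" (infix "majorizes" 50) where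
  "x majorizes y \<longleftrightarrow> (\<Sum>i\<in>UNIV. x $ i) = (\<Sum>i\<in>UNIV. y $ i) \<and>
     (\<forall>j\<in>{1..CARD('n)}. sum_largest j y \<le> sum_largest j x)"

definition OPT :: "'n::finite request list \<Rightarrow> real ^ 'n" where
  "OPT E = (THE x. x \<in> feasible_loads E \<and> (\<forall>l \<in> feasible_loads E. l majorizes x))"

text \<open>
  A rule maps the requests up to and including the current one, and the list of allocations made
  for the earlier requests, to the current allocation.
\<close>

type_synonym 'n rule = "'n request list \<Rightarrow> (real ^ 'n) list \<Rightarrow> real ^ 'n"

primrec run_upto :: "'n::finite rule \<Rightarrow> 'n request list \<Rightarrow> nat \<Rightarrow> (real ^ 'n) list" where
  "run_upto A E 0 = []"
| "run_upto A E (Suc t) = run_upto A E t @ [A (take (Suc t) E) (run_upto A E t)]"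

definition run :: "'n::finite rule \<Rightarrow> 'n request list \<Rightarrow> (real ^ 'n) list" where
  "run A E = run_upto A E (length E)"

definition final_load :: "'n::finite rule \<Rightarrow> 'n request list \<Rightarrow> real ^ 'n" where
  "final_load A E = sum_list (run A E)"

definition feasible_rule :: "'n::finite rule \<Rightarrow> bool" where
  "feasible_rule A \<longleftrightarrow>
     (\<forall>E N r xs. request_seq (E @ [(N, r)]) \<and> list_all2 (\<lambda>(N', r') x. x \<in> allocs N' r') E xs
        \<longrightarrow> A (E @ [(N, r)]) xs \<in> allocs N r)"

text \<open>
  A randomized policy draws all of its internal randomness \<open>\<omega>\<close> from a probability space and then
  follows the rule \<open>A \<omega>\<close>. Measurability is only required of the realized allocations on each fixed
  request sequence. A deterministic policy is the case where \<open>A\<close> is constant.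
\<close>

definition allocation_policy :: "'w measure \<Rightarrow> ('w \<Rightarrow> 'n::finite rule) \<Rightarrow> bool" where
  "allocation_policy M A \<longleftrightarrow> prob_space M \<and> (\<forall>\<omega> \<in> space M. feasible_rule (A \<omega>)) \<and>
     (\<forall>E. request_seq E \<longrightarrow> (\<forall>t<length E. (\<lambda>\<omega>. run (A \<omega>) E ! t) \<in> borel_measurable M))"

definition expected_load :: "'w measure \<Rightarrow> ('w \<Rightarrow> 'n::finite rule) \<Rightarrow> 'n request list \<Rightarrow> real ^ 'n" where
  "expected_load M A E = (\<integral>\<omega>. final_load (A \<omega>) E \<partial>M)"

definition water_filling :: "'n::finite rule" where
  "water_filling E xs = (let (N, r) = last E; l = sum_list xs in
     THE x. is_arg_max (\<lambda>x. Min ((\<lambda>i. x $ i + l $ i) ` N)) (\<lambda>x. x \<in> allocs N r) x)"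

definition WF :: "'n::finite request list \<Rightarrow> real ^ 'n" where
  "WF E = final_load water_filling E"

end

(* Let w = WF(E), and let h_t be the water level at which request t is served. The neighborhood of
   t lies in the level set W_t = {i. h_t <= w_i}; replacing it by W_t and sorting by h_t gives a
   nested sequence with more feasible loads, hence with an optimum that OPT(E) majorizes. The
   adversary E' keeps the cardinalities of these sets, but each new neighborhood consists of those
   nodes of the previous one with the largest expected load so far. Its expected load on the t-th
   neighborhood is then at least w(W_t). As the nonempty sets {i. c < w_i} with c >= 0 are among
   the W_t, this gives majorization, and nested sequences with the same cardinalities and
   quantities have the same optimum up to a permutation of the nodes. *)
theory Submission imports Defs begin

section \<open>Majorization\<close>

text \<open>\<open>sum_largest\<close> is defined on the multiset of entries and forgets the nodes.
  Sorting the nodes themselves by their entries recovers a set \<open>S\<close> of nodes carrying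
  the sum, separated from the other nodes by a threshold.\<close>

lemma sum_largest_attained:
  fixes x :: "real ^ 'n::finite"
  assumes "j \<le> CARD('n)"
  obtains S where "card S = j" "sum_largest j x = (\<Sum>i\<in>S. x $ i)"
    "\<And>i k. i \<in> S \<Longrightarrow> k \<notin> S \<Longrightarrow> x $ k \<le> x $ i"
proof -
  obtain us :: "'n list" where us: "set us = UNIV" "distinct us"
    using finite_distinct_list[of "UNIV :: 'n set"] by auto
  define vs where "vs = sort_key (($) x) us"
  define ws where "ws = rev vs"
  have vs: "set vs = UNIV" "distinct vs" "sorted (map (($) x) vs)"
    using us by (auto simp: vs_def)
  have mv: "mset vs = mset_set UNIV"
    using vs by (metis mset_set_set)
  have "sorted_list_of_multiset (image_mset (($) x) (mset_set UNIV)) = map (($) x) vs"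
    using vs(3) by (metis mv mset_map sorted_list_of_multiset_mset sorted_sort_id)
  then have sl: "sum_largest j x = sum_list (map (($) x) (take j ws))"
    by (simp add: sum_largest_def ws_def rev_map take_map)
  have isd: "distinct ws" "set ws = UNIV" "length ws = CARD('n)"
    using vs distinct_card[of vs] by (auto simp: ws_def)
  have ordered: "sorted_wrt (\<lambda>i k. x $ k \<le> x $ i) ws"
    using vs(3) by (simp add: ws_def sorted_wrt_rev sorted_wrt_map)
  show thesis
  proof
    show "card (set (take j ws)) = j"
      using isd assms by (simp add: distinct_card)
    show "sum_largest j x = (\<Sum>i\<in>set (take j ws). x $ i)"
      using isd by (simp add: sl sum_list_distinct_conv_sum_set)
    fix i k assume "i \<in> set (take j ws)" "k \<notin> set (take j ws)"
    moreover have "k \<in> set (take j ws) \<union> set (drop j ws)"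
      using isd(2) by (metis UNIV_I append_take_drop_id set_append)
    moreover have "sorted_wrt (\<lambda>i k. x $ k \<le> x $ i) (take j ws @ drop j ws)"
      using ordered by simp
    ultimately show "x $ k \<le> x $ i"
      unfolding sorted_wrt_append by blast
  qed
qed

text \<open>With \<open>c\<close> the \<open>j\<close>-th largest entry of \<open>x\<close>, both sums of \<open>j\<close> largest entries are compared
  through the sums over all nodes of the positive parts beyond \<open>c\<close>.\<close>

lemma majorizesI:
  fixes x y :: "real ^ 'n::finite"
  assumes total: "(\<Sum>i\<in>UNIV. x $ i) = (\<Sum>i\<in>UNIV. y $ i)"
    and upper: "\<And>c. \<exists>S. card S = card {i. c < y $ i} \<and> (\<Sum>i | c < y $ i. y $ i) \<le> (\<Sum>i\<in>S. x $ i)"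
  shows "x majorizes y"
  unfolding majorizes_def
proof (intro conjI ballI total)
  fix j assume j: "j \<in> {1..CARD('n)}"
  obtain S where S: "card S = j" "sum_largest j x = (\<Sum>i\<in>S. x $ i)"
    "\<And>i k. i \<in> S \<Longrightarrow> k \<notin> S \<Longrightarrow> x $ k \<le> x $ i"
    using sum_largest_attained[of j x] j by auto
  obtain T where T: "card T = j" "sum_largest j y = (\<Sum>i\<in>T. y $ i)"
    using sum_largest_attained[of j y] j by auto
  have "S \<noteq> {}" using S(1) j by auto
  define c where "c = Min (($) x ` S)"
  have cS: "c \<le> x $ i" if "i \<in> S" for i using that by (simp add: c_def)
  have "c \<in> ($) x ` S" unfolding c_def using \<open>S \<noteq> {}\<close> by (intro Min_in) auto
  then have cC: "x $ k \<le> c" if "k \<notin> S" for k using S(3) that by auto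
  obtain R where R: "card R = card {i. c < y $ i}"
    "(\<Sum>i | c < y $ i. y $ i) \<le> (\<Sum>i\<in>R. x $ i)" using upper by blast
  have "(\<Sum>i\<in>T. y $ i - c) \<le> (\<Sum>i\<in>T. max 0 (y $ i - c))"
    by (intro sum_mono) auto
  also have "\<dots> \<le> (\<Sum>i\<in>UNIV. max 0 (y $ i - c))"
    by (intro sum_mono2) auto
  also have "\<dots> = (\<Sum>i | c < y $ i. y $ i - c)"
    by (intro sum.mono_neutral_cong_right) auto
  also have "\<dots> \<le> (\<Sum>i\<in>R. x $ i - c)"
    using R by (simp add: sum_subtractf)
  also have "\<dots> \<le> (\<Sum>i\<in>R. max 0 (x $ i - c))"
    by (intro sum_mono) auto
  also have "\<dots> \<le> (\<Sum>i\<in>UNIV. max 0 (x $ i - c))"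
    by (intro sum_mono2) auto
  \<comment> \<open>No positive part is lost or added: entries on \<open>S\<close> are at least
    \<open>c\<close>, all others at most \<open>c\<close>.\<close>
  also have "\<dots> = (\<Sum>i\<in>S. x $ i - c)"
    using cS cC by (intro sum.mono_neutral_cong_right) (auto simp: max_def intro: antisym)
  finally show "sum_largest j y \<le> sum_largest j x"
    using S(1,2) T by (simp add: sum_subtractf)
qed

text \<open>\<open>sum_largest\<close> depends only on the multiset of entries, which renaming the
  nodes preserves.\<close>

lemma majorizes_permute:
  fixes x :: "real ^ 'n::finite"
  assumes "bij \<sigma>" and "(\<chi> i. x $ \<sigma> i) majorizes y"
  shows "x majorizes y"
proof -
  have "image_mset (($) (\<chi> i. x $ \<sigma> i)) (mset_set UNIV) =
      image_mset (($) x) (image_mset \<sigma> (mset_set UNIV))"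
    unfolding multiset.map_comp by (intro image_mset_cong) simp
  also have "image_mset \<sigma> (mset_set UNIV) = mset_set UNIV"
    using assms(1) by (simp add: image_mset_mset_set bij_is_inj bij_is_surj)
  finally have "sum_largest j (\<chi> i. x $ \<sigma> i) = sum_largest j x" for j
    unfolding sum_largest_def by presburger
  moreover have "(\<Sum>i\<in>UNIV. x $ \<sigma> i) = (\<Sum>i\<in>UNIV. x $ i)"
    using assms(1) by (intro sum.reindex_bij_betw)
  ultimately show ?thesis
    using assms(2) by (simp add: majorizes_def)
qed

text \<open>Mutual majorization makes the sorted entry lists equal, hence also the sums of squares.
  This is the link between least elements for majorization and points of least norm, and it gives
  the uniqueness of \<open>OPT\<close>.\<close>

lemma majorizes_antisym_norm:
  fixes x y :: "real ^ 'n::finite"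
  assumes "x majorizes y" "y majorizes x"
  shows "norm x = norm y"
proof -
  define L :: "real ^ 'n \<Rightarrow> real list" where
    "L z = rev (sorted_list_of_multiset (image_mset (($) z) (mset_set UNIV)))" for z
  have len: "length (L z) = CARD('n)" for z
    by (simp add: L_def flip: size_mset)
  have pre: "sum_list (take j (L x)) = sum_list (take j (L y))" if "j \<le> CARD('n)" for j
  proof (cases "j = 0")
    case False
    then have "j \<in> {1..CARD('n)}" using that by simp
    then have "sum_largest j x = sum_largest j y"
      using assms by (metis antisym majorizes_def)
    then show ?thesis by (simp add: sum_largest_def L_def)
  qed simp
  \<comment> \<open>Each sorted entry is the difference of two consecutive prefix sums.\<close>
  have "L x = L y"
  proof (rule nth_equalityI)
    fix j assume "j < length (L x)"
    then show "L x ! j = L y ! j"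
      using pre[of j] pre[of "Suc j"] by (simp add: len take_Suc_conv_app_nth)
  qed (simp add: len)
  then have "mset (L x) = mset (L y)" by simp
  then have "image_mset (($) x) (mset_set UNIV) = image_mset (($) y) (mset_set UNIV)"
    by (simp add: L_def)
  then have "\<Sum>\<^sub># (image_mset (\<lambda>a. a\<^sup>2) (image_mset (($) x) (mset_set UNIV))) =
      \<Sum>\<^sub># (image_mset (\<lambda>a. a\<^sup>2) (image_mset (($) y) (mset_set UNIV)))"
    by simp
  then have "(\<Sum>i\<in>UNIV. (x $ i)\<^sup>2) = (\<Sum>i\<in>UNIV. (y $ i)\<^sup>2)"
    by (simp add: multiset.map_comp comp_def sum_unfold_sum_mset)
  then show ?thesis
    by (simp add: norm_vec_def L2_set_def)
qed

section \<open>Feasible loads and the optimal load\<close>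

abbreviation feasible_allocs :: "'n::finite request list \<Rightarrow> (real ^ 'n) list \<Rightarrow> bool" where
  "feasible_allocs \<equiv> list_all2 (\<lambda>(N, r) x. x \<in> allocs N r)"

lemma sum_list_vec_nth: "sum_list xs $ i = (\<Sum>t<length xs. xs ! t $ i)"
  by (simp add: sum_list_sum_nth atLeast0LessThan)

lemma sum_list_vec_sum: "(\<Sum>i\<in>S. sum_list xs $ i) = (\<Sum>t<length xs. \<Sum>i\<in>S. xs ! t $ i)"
  unfolding sum_list_vec_nth by (rule sum.swap)

lemma feasible_loads_iff:
  "l \<in> feasible_loads E \<longleftrightarrow> (\<exists>xs. feasible_allocs E xs \<and> l = sum_list xs)"
proof (induction E arbitrary: l)
  case Nil
  then show ?case by (simp add: feasible_loads_def)
next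
  case (Cons e E)
  obtain N r where e: "e = (N, r)" by force
  have "l \<in> feasible_loads (e # E) \<longleftrightarrow> (\<exists>a\<in>allocs N r. \<exists>b\<in>feasible_loads E. l = a + b)"
    by (simp add: feasible_loads_def e set_plus_def)
  also have "\<dots> \<longleftrightarrow> (\<exists>xs. feasible_allocs (e # E) xs \<and> l = sum_list xs)"
  proof
    assume "\<exists>a\<in>allocs N r. \<exists>b\<in>feasible_loads E. l = a + b"
    then obtain a xs where "a \<in> allocs N r" "feasible_allocs E xs" "l = a + sum_list xs"
      by (auto simp: Cons.IH)
    then show "\<exists>xs. feasible_allocs (e # E) xs \<and> l = sum_list xs"
      by (intro exI[of _ "a # xs"]) (simp add: e)
  next
    assume "\<exists>xs. feasible_allocs (e # E) xs \<and> l = sum_list xs"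
    then obtain a xs where "a \<in> allocs N r" "feasible_allocs E xs" "l = a + sum_list xs"
      by (auto simp: list_all2_Cons1 e)
    then show "\<exists>a\<in>allocs N r. \<exists>b\<in>feasible_loads E. l = a + b"
      using Cons.IH[of "sum_list xs"] by blast
  qed
  finally show ?case .
qed
lemma allocs_mono: "N \<subseteq> N' \<Longrightarrow> allocs N r \<subseteq> allocs N' r"
  by (auto simp: allocs_def)

lemma sum_allocs:
  assumes "x \<in> allocs N r" "N \<subseteq> S"
  shows "(\<Sum>i\<in>S. x $ i) = r"
proof -
  have "(\<Sum>i\<in>S. x $ i) = (\<Sum>i\<in>UNIV. x $ i)"
    using assms by (intro sum.mono_neutral_left) (auto simp: allocs_def)
  then show ?thesis using assms by (simp add: allocs_def)
qed

lemma sum_allocs_le: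
  assumes "x \<in> allocs N r"
  shows "(\<Sum>i\<in>S. x $ i) \<le> r"
proof -
  have "(\<Sum>i\<in>S. x $ i) \<le> (\<Sum>i\<in>UNIV. x $ i)"
    using assms by (intro sum_mono2) (auto simp: allocs_def)
  then show ?thesis using assms by (simp add: allocs_def)
qed

lemma allocs_nonneg: "x \<in> allocs N r \<Longrightarrow> 0 \<le> x $ i"
  by (simp add: allocs_def)

lemma sum_feasible_load:
  assumes "l \<in> feasible_loads E"
  shows "(\<Sum>i\<in>UNIV. l $ i) = sum_list (map snd E)"
proof -
  obtain xs where xs: "feasible_allocs E xs" "l = sum_list xs"
    using assms by (auto simp: feasible_loads_iff)
  from xs(1) have "(\<Sum>i\<in>UNIV. sum_list xs $ i) = sum_list (map snd E)"
    by induction (auto simp: sum.distrib allocs_def)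
  then show ?thesis by (simp add: xs)
qed

lemma compact_convex_allocs: "compact (allocs N r)" "convex (allocs N r)"
proof -
  have eq: "allocs N r = (\<Inter>i. {x. 0 \<le> x $ i}) \<inter> (\<Inter>i\<in>- N. {x. x $ i = 0}) \<inter>
      {x. (\<Sum>i\<in>UNIV. x $ i) = r}"
    by (auto simp: allocs_def)
  have "closed (allocs N r)"
    unfolding eq
    by (intro closed_Int closed_INT ballI closed_Collect_le closed_Collect_eq continuous_intros)
  moreover have "bounded (allocs N r)"
  proof (rule boundedI)
    fix x :: "real ^ 'a" assume "x \<in> allocs N r"
    then show "norm x \<le> r"
      using norm_le_l1_cart[of x] by (simp add: allocs_def)
  qed
  ultimately show "compact (allocs N r)" by (simp add: compact_eq_bounded_closed)
  show "convex (allocs N r)"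
  proof (rule convexI)
    fix x y :: "real ^ 'a" and u v :: real
    assume *: "x \<in> allocs N r" "y \<in> allocs N r" "0 \<le> u" "0 \<le> v" "u + v = 1"
    have "(\<Sum>i\<in>UNIV. u * x $ i + v * y $ i) = u * r + v * r"
      using * by (simp add: allocs_def sum.distrib flip: sum_distrib_left)
    also have "\<dots> = r" using * by (metis distrib_right mult_1)
    finally show "u *\<^sub>R x + v *\<^sub>R y \<in> allocs N r"
      using * by (simp add: allocs_def)
  qed
qed

text \<open>These properties provide a unique point of least norm. Compactness rather than
  closedness is carried through the induction, because Minkowski sums of closed sets need not be
  closed.\<close>

lemma compact_convex_feasible_loads: "compact (feasible_loads E)" "convex (feasible_loads E)"
proof (induction E)
  case (Cons e E)
  obtain N r where e: "e = (N, r)" by force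
  have eq: "feasible_loads (e # E) = allocs N r + feasible_loads E"
    by (simp add: feasible_loads_def e)
  show "compact (feasible_loads (e # E))"
    using compact_sums[OF compact_convex_allocs(1)[of N r] Cons(1)]
    by (rule back_subst[of compact]) (auto simp: eq set_plus_def)
  show "convex (feasible_loads (e # E))"
    unfolding eq by (intro convex_set_plus compact_convex_allocs Cons)
qed (simp_all add: feasible_loads_def)

lemma feasible_loads_nonempty:
  assumes "request_seq E"
  shows "feasible_loads E \<noteq> {}"
  using assms
proof (induction E)
  case (Cons e E)
  obtain N r where e: "e = (N, r)" by force
  obtain i where "i \<in> N" "0 < r" using Cons.prems by (auto simp: request_seq_def e)
  then have "axis i r \<in> allocs N r"
    by (auto simp: allocs_def axis_def)
  moreover have "feasible_loads E \<noteq> {}"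
    using Cons by (simp add: request_seq_def)
  ultimately show ?case
    by (auto simp: feasible_loads_def e set_plus_def)
qed (simp add: feasible_loads_def)

lemma sum_list_update_group:
  fixes xs :: "'a::ab_group_add list"
  shows "t < length xs \<Longrightarrow> sum_list (xs[t := v]) = sum_list xs + (v - xs ! t)"
proof (induction xs arbitrary: t)
  case (Cons x xs)
  then show ?case by (cases t) (auto simp: algebra_simps)
qed simp

text \<open>At a load of minimal norm no request can shift load towards a less loaded node. Hence a
  request serving a node of an upper level set has its whole neighborhood in that set, so every
  feasible load puts at least as much on it.\<close>

lemma majorizes_min_norm:
  assumes x: "x \<in> feasible_loads E"
    and min: "\<And>y. y \<in> feasible_loads E \<Longrightarrow> 0 \<le> x \<bullet> (y - x)"
    and l: "l \<in> feasible_loads E"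
  shows "l majorizes x"
proof (rule majorizesI)
  show "(\<Sum>i\<in>UNIV. l $ i) = (\<Sum>i\<in>UNIV. x $ i)"
    using x l by (simp add: sum_feasible_load)
  obtain xs where xs: "feasible_allocs E xs" "x = sum_list xs"
    using x by (auto simp: feasible_loads_iff)
  obtain ls where ls: "feasible_allocs E ls" "l = sum_list ls"
    using l by (auto simp: feasible_loads_iff)
  have len: "length xs = length E" "length ls = length E"
    using xs ls by (auto dest: list_all2_lengthD)
  have le: "x $ i \<le> x $ j"
    if t: "t < length E" "i \<in> fst (E ! t)" "j \<in> fst (E ! t)" "0 < xs ! t $ i" for t i j
  proof (cases "i = j")
    case False
    obtain N r where Et: "E ! t = (N, r)" by force
    define e where "e = xs ! t $ i"
    \<comment> \<open>Moves everything that request \<open>t\<close> puts on \<open>i\<close> over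
      to \<open>j\<close>. The inner product of \<open>x\<close> with this direction is
      \<open>e * (x $ j - x $ i)\<close>, and minimality makes it nonnegative.\<close>
    define d where "d = e *\<^sub>R (axis j 1 - axis i 1 :: real ^ 'a)"
    have d: "d $ k = (if k = j then e else if k = i then - e else 0)" for k
      using False by (auto simp: d_def axis_def)
    have xt: "xs ! t \<in> allocs N r"
      using xs(1) t(1) Et by (auto simp: list_all2_conv_all_nth)
    have "(\<Sum>k\<in>UNIV. d $ k) = (\<Sum>k\<in>{i, j}. d $ k)"
      by (intro sum.mono_neutral_right) (auto simp: d)
    also have "\<dots> = 0" using False by (simp add: d)
    finally have "xs ! t + d \<in> allocs N r"
      using xt t Et by (auto simp: allocs_def sum.distrib d e_def)
    \<comment> \<open>The update of \<open>E\<close> changes nothing; it only matches the update of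
      \<open>xs\<close>.\<close>
    then have "feasible_allocs (E[t := E ! t]) (xs[t := xs ! t + d])"
      by (intro list_all2_update_cong xs(1)) (simp add: Et)
    then have "feasible_allocs E (xs[t := xs ! t + d])" by simp
    moreover have "sum_list (xs[t := xs ! t + d]) = x + d"
      using t(1) len xs by (simp add: sum_list_update_group)
    ultimately have "x + d \<in> feasible_loads E"
      by (metis feasible_loads_iff)
    from min[OF this] have "0 \<le> e * (x $ j - x $ i)"
      by (simp add: d_def inner_diff_right inner_axis)
    then show ?thesis using t(4) by (simp add: e_def zero_le_mult_iff)
  qed simp
  fix c
  let ?U = "{i. c < x $ i}"
  have "(\<Sum>i\<in>?U. xs ! t $ i) \<le> (\<Sum>i\<in>?U. ls ! t $ i)" if t: "t < length E" for t
  proof -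
    obtain N r where Et: "E ! t = (N, r)" by force
    have al: "xs ! t \<in> allocs N r" "ls ! t \<in> allocs N r"
      using xs(1) ls(1) t Et by (auto simp: list_all2_conv_all_nth)
    show ?thesis
    proof (cases "\<exists>i\<in>?U. 0 < xs ! t $ i")
      case True
      then obtain i where i: "c < x $ i" "0 < xs ! t $ i" by blast
      then have "i \<in> N" using al(1) by (force simp: allocs_def)
      then have "N \<subseteq> ?U" using le[OF t _ _ i(2)] i(1) Et by fastforce
      then show ?thesis
        using sum_allocs_le[OF al(1)] sum_allocs[OF al(2)] by simp
    next
      case False
      then have "(\<Sum>i\<in>?U. xs ! t $ i) \<le> 0" by (intro sum_nonpos) auto
      also have "\<dots> \<le> (\<Sum>i\<in>?U. ls ! t $ i)"
        using allocs_nonneg[OF al(2)] by (intro sum_nonneg) auto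
      finally show ?thesis .
    qed
  qed
  then have "(\<Sum>t<length E. \<Sum>i\<in>?U. xs ! t $ i) \<le> (\<Sum>t<length E. \<Sum>i\<in>?U. ls ! t $ i)"
    by (rule sum_mono) simp
  then have "(\<Sum>i\<in>?U. x $ i) \<le> (\<Sum>i\<in>?U. l $ i)"
    using sum_list_vec_sum[of xs ?U] sum_list_vec_sum[of ls ?U] by (simp add: xs(2) ls(2) len)
  then show "\<exists>S. card S = card ?U \<and> (\<Sum>i\<in>?U. x $ i) \<le> (\<Sum>i\<in>S. l $ i)"
    by blast
qed

text \<open>The point of the feasible set closest to 0 satisfies the variational inequality of
  \<open>majorizes_min_norm\<close>, so every feasible load majorizes it. Any other least element
  has the same norm and coincides with it, as the closest point of a closed convex set is unique.
  This justifies the definite description in \<open>OPT\<close>.\<close>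

lemma OPT_least:
  assumes "request_seq E"
  shows "OPT E \<in> feasible_loads E" "\<And>l. l \<in> feasible_loads E \<Longrightarrow> l majorizes OPT E"
proof -
  let ?D = "feasible_loads E"
  note cl = compact_imp_closed[OF compact_convex_feasible_loads(1), of E]
  note cv = compact_convex_feasible_loads(2)[of E]
  define p where "p = closest_point ?D 0"
  have p: "p \<in> ?D" "\<And>y. y \<in> ?D \<Longrightarrow> norm p \<le> norm y"
    using closest_point_exists[OF cl feasible_loads_nonempty[OF assms], of 0] by (auto simp: p_def)
  have "0 \<le> p \<bullet> (y - p)" if "y \<in> ?D" for y
    using closest_point_dot[OF cv cl that, of 0] by (simp add: p_def)
  then have maj: "l majorizes p" if "l \<in> ?D" for l
    using majorizes_min_norm[OF p(1)] that by blast
  have "OPT E = p"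
    unfolding OPT_def
  proof (rule the_equality)
    fix y assume y: "y \<in> ?D \<and> (\<forall>l\<in>?D. l majorizes y)"
    then have "norm y = norm p"
      using maj p(1) by (intro majorizes_antisym_norm) auto
    then have "\<forall>z\<in>?D. dist 0 y \<le> dist 0 z" using p(2) by simp
    then show "y = p"
      unfolding p_def using y by (intro closest_point_unique[OF cv cl]) auto
  qed (use p maj in auto)
  then show "OPT E \<in> ?D" "\<And>l. l \<in> ?D \<Longrightarrow> l majorizes OPT E"
    using p maj by auto
qed

section \<open>Nested sequences up to a renaming of the nodes\<close>

text \<open>A bijection matching the inner sets of the chains is extended by an arbitrary bijection
  between \<open>A - W\<close> and \<open>B - N\<close>, which are equally large. Later sets lie
  inside \<open>W\<close>, so the extension does not alter their images.\<close>

lemma bij_betw_chains: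
  assumes "finite A" "finite B" "card A = card B"
    and "sorted_wrt (\<supseteq>) (A # Ws)" "sorted_wrt (\<supseteq>) (B # Ns)"
    and "map card Ws = map card Ns"
  shows "\<exists>\<sigma>. bij_betw \<sigma> A B \<and> list_all2 (\<lambda>W N. \<sigma> ` W = N) Ws Ns"
  using assms
proof (induction Ws arbitrary: A B Ns)
  case Nil
  then show ?case using finite_same_card_bij by fastforce
next
  case (Cons W Ws)
  obtain N Ns' where Ns: "Ns = N # Ns'" "card W = card N" "map card Ws = map card Ns'"
    using Cons.prems by (cases Ns) auto
  have sub: "W \<subseteq> A" "N \<subseteq> B" "\<And>V. V \<in> set Ws \<Longrightarrow> V \<subseteq> W"
    using Cons.prems Ns by auto
  have fin: "finite W" "finite N"
    using sub Cons.prems finite_subset by auto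
  obtain \<sigma> where \<sigma>: "bij_betw \<sigma> W N" "list_all2 (\<lambda>W N. \<sigma> ` W = N) Ws Ns'"
    using Cons.IH[OF fin Ns(2), of Ns'] Cons.prems Ns by auto
  have "card (A - W) = card (B - N)"
    using sub fin Ns Cons.prems by (simp add: card_Diff_subset)
  then obtain \<tau> where \<tau>: "bij_betw \<tau> (A - W) (B - N)"
    using finite_same_card_bij[of "A - W" "B - N"] Cons.prems by auto
  define \<rho> where "\<rho> i = (if i \<in> W then \<sigma> i else \<tau> i)" for i
  have "bij_betw \<rho> (W \<union> (A - W)) (N \<union> (B - N))"
    unfolding \<rho>_def using \<sigma>(1) \<tau> by (intro bij_betw_disjoint_Un) auto
  then have "bij_betw \<rho> A B"
    using sub by (simp add: Un_absorb1)
  moreover have eq: "\<rho> ` V = \<sigma> ` V" if "V \<subseteq> W" for V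
    using that by (auto simp: \<rho>_def intro!: image_cong)
  have "list_all2 (\<lambda>W N. \<rho> ` W = N) Ws Ns'"
    using \<sigma>(2) by (rule list.rel_mono_strong) (use sub(3) eq in auto)
  then have "list_all2 (\<lambda>W N. \<rho> ` W = N) (W # Ws) Ns"
    using \<sigma>(1) eq[of W] by (simp add: Ns bij_betw_def)
  ultimately show ?case by blast
qed

text \<open>The permutation that matches the two chains of neighborhoods carries \<open>x\<close> to
  a feasible load of \<open>E'\<close>. An arbitrary feasible \<open>x\<close> is allowed because
  the lemma is applied to the optimum of a different sequence whose loads are all feasible for
  \<open>E\<close>.\<close>

lemma OPT_majorizes_OPT_same_cards:
  fixes E E' :: "'n::finite request list"
  assumes seq: "request_seq E'" and x: "x \<in> feasible_loads E"
    and nested: "sorted_wrt (\<supseteq>) (map fst E)" "sorted_wrt (\<supseteq>) (map fst E')"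
    and same: "list_all2 (\<lambda>(N, r) (N', r'). card N = card N' \<and> r = r') E E'"
  shows "x majorizes OPT E'"
proof -
  have "map card (map fst E) = map card (map fst E')"
    using same by (auto simp: list_all2_conv_all_nth case_prod_unfold intro: nth_equalityI)
  then obtain \<sigma> where \<sigma>: "bij \<sigma>" "list_all2 (\<lambda>W N. \<sigma> ` W = N) (map fst E) (map fst E')"
    using bij_betw_chains[of UNIV UNIV "map fst E" "map fst E'"] nested by auto
  have bij': "bij (inv \<sigma>)" using \<sigma>(1) by (rule bij_imp_bij_inv)
  obtain xs where xs: "feasible_allocs E xs" "x = sum_list xs"
    using x by (auto simp: feasible_loads_iff)
  define p where "p y = (\<chi> i. y $ inv \<sigma> i)" for y :: "real ^ 'n"
  have "feasible_allocs E' (map p xs)"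
    unfolding list_all2_conv_all_nth
  proof (intro conjI allI impI)
    show "length E' = length (map p xs)"
      using xs(1) same by (metis length_map list_all2_lengthD)
    fix t assume t: "t < length E'"
    have len: "length E = length E'" "length xs = length E'"
      using xs(1) same by (metis list_all2_lengthD)+
    obtain N r where Et: "E ! t = (N, r)" by force
    obtain N' r' where Et': "E' ! t = (N', r')" by force
    have r: "r' = r" using same t len Et Et' by (auto simp: list_all2_conv_all_nth)
    have N': "N' = \<sigma> ` N"
      using list_all2_nthD2[OF \<sigma>(2), of t] t len Et Et' by simp
    have al: "xs ! t \<in> allocs N r"
      using xs(1) t len Et by (auto simp: list_all2_conv_all_nth)
    have "inv \<sigma> i \<notin> N" if "i \<notin> N'" for i
      using that \<sigma>(1) by (auto simp: N' bij_inv_eq_iff image_iff) (metis bij_inv_eq_iff)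
    moreover have "(\<Sum>i\<in>UNIV. xs ! t $ inv \<sigma> i) = (\<Sum>i\<in>UNIV. xs ! t $ i)"
      using bij' by (intro sum.reindex_bij_betw)
    ultimately have "p (xs ! t) \<in> allocs N' r'"
      using al by (auto simp: allocs_def p_def r)
    then show "(case E' ! t of (N, r) \<Rightarrow> \<lambda>x. x \<in> allocs N r) (map p xs ! t)"
      using t len by (simp add: Et')
  qed
  moreover have "sum_list (map p xs) = p x"
    unfolding xs(2) by (induction xs) (auto simp: p_def vec_eq_iff)
  ultimately have "p x \<in> feasible_loads E'"
    by (metis feasible_loads_iff)
  then have "p x majorizes OPT E'"
    using OPT_least seq by blast
  then show ?thesis
    using majorizes_permute[OF bij'] by (simp add: p_def)
qed

section \<open>Water levels\<close>

text \<open>Intermediate value theorem: the quantity poured up to level \<open>h\<close> is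
  continuous in \<open>h\<close>, vanishes at the least load, and is at least \<open>r\<close> at
  height \<open>r\<close> above any single node.\<close>

lemma water_level_exists:
  fixes l :: "'a \<Rightarrow> real"
  assumes "finite N" "N \<noteq> {}" "0 \<le> r"
  shows "\<exists>h. (\<Sum>i\<in>N. max 0 (h - l i)) = r"
proof -
  define g where "g h = (\<Sum>i\<in>N. max 0 (h - l i))" for h
  obtain k where k: "k \<in> N" using assms(2) by blast
  define a where "a = Min (l ` N)"
  have a: "a \<le> l i" if "i \<in> N" for i using that assms(1) by (simp add: a_def)
  have "g a = 0" unfolding g_def using a by (intro sum.neutral) auto
  moreover have "r \<le> g (l k + r)"
  proof -
    have "r \<le> (\<Sum>i\<in>{k}. max 0 (l k + r - l i))" by simp
    also have "\<dots> \<le> g (l k + r)"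
      unfolding g_def using k assms(1) by (intro sum_mono2) auto
    finally show ?thesis .
  qed
  moreover have "a \<le> l k + r" using a[OF k] assms(3) by simp
  moreover have "continuous_on {a..l k + r} g"
    unfolding g_def by (intro continuous_intros)
  ultimately obtain h where "g h = r"
    using IVT'[of g a r "l k + r"] assms(3) by auto
  then show ?thesis by (auto simp: g_def)
qed

text \<open>The allocation \<open>y\<close> that raises all nodes of \<open>N\<close> below
  \<open>h\<close> exactly to \<open>h\<close> is the unique maximizer: an allocation whose minimum
  is at least \<open>h\<close> dominates \<open>y\<close> on \<open>N\<close> and has the same
  total, so it equals \<open>y\<close>.\<close>

lemma water_filling_level:
  fixes xs :: "(real ^ 'n::finite) list" and E :: "'n request list"
  assumes "N \<noteq> {}" "0 < r"
  defines "x \<equiv> water_filling (E @ [(N, r)]) xs" and "l \<equiv> sum_list xs"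
  shows "x \<in> allocs N r"
    and "\<exists>h. (\<forall>i\<in>N. h \<le> (l + x) $ i) \<and> (\<forall>i. 0 < x $ i \<longrightarrow> (l + x) $ i = h)"
proof -
  obtain h where h: "(\<Sum>i\<in>N. max 0 (h - l $ i)) = r"
    using water_level_exists[of N r "($) l"] assms by auto
  define y where "y = (\<chi> i. if i \<in> N then max 0 (h - l $ i) else 0)"
  have y: "y \<in> allocs N r"
    by (simp add: allocs_def y_def h sum.If_cases)
  define f where "f z = Min ((\<lambda>i. z $ i + l $ i) ` N)" for z :: "real ^ 'n"
  \<comment> \<open>As \<open>r\<close> is positive, some node is really raised. It ends at level
    \<open>h\<close>, so the minimum \<open>f y\<close> does not exceed \<open>h\<close>.\<close>
  have "\<exists>i\<in>N. l $ i < h"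
  proof (rule ccontr)
    assume "\<not> ?thesis"
    then have "(\<Sum>i\<in>N. max 0 (h - l $ i)) = 0" by (intro sum.neutral) (auto simp: not_less)
    then show False using h assms by simp
  qed
  then obtain k where k: "k \<in> N" "l $ k < h" by blast
  have "f y \<le> y $ k + l $ k" unfolding f_def using k by (intro Min_le) auto
  then have fy_le: "f y \<le> h" using k by (simp add: y_def)
  have unique: "z = y" if z: "z \<in> allocs N r" "h \<le> f z" for z
  proof -
    have le: "y $ i \<le> z $ i" if "i \<in> N" for i
    proof -
      have "f z \<le> z $ i + l $ i" unfolding f_def using that by (intro Min_le) auto
      then show ?thesis using z(2) allocs_nonneg[OF z(1), of i] by (simp add: y_def)
    qed
    have "(\<Sum>i\<in>N. z $ i - y $ i) = 0"
      using sum_allocs[OF z(1)] sum_allocs[OF y] by (simp add: sum_subtractf)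
    then have "\<forall>i\<in>N. z $ i - y $ i = 0"
      using le by (subst (asm) sum_nonneg_eq_0_iff) auto
    then show ?thesis using z(1) y by (auto simp: vec_eq_iff allocs_def)
  qed
  have "h \<le> f y" unfolding f_def using assms(1) by (subst Min_ge_iff) (auto simp: y_def)
  with fy_le have fy: "f y = h" by simp
  have "x = (THE z. is_arg_max f (\<lambda>z. z \<in> allocs N r) z)"
    by (simp add: x_def water_filling_def f_def[abs_def] l_def)
  also have "\<dots> = y"
  proof (rule the_equality)
    show "is_arg_max f (\<lambda>z. z \<in> allocs N r) y"
      unfolding is_arg_max_def using y unique fy by force
    fix z assume "is_arg_max f (\<lambda>z. z \<in> allocs N r) z"
    then show "z = y"
      unfolding is_arg_max_def using y unique fy by (metis not_less)
  qed
  finally have xy: "x = y" .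
  show "x \<in> allocs N r" using y by (simp add: xy)
  show "\<exists>h. (\<forall>i\<in>N. h \<le> (l + x) $ i) \<and> (\<forall>i. 0 < x $ i \<longrightarrow> (l + x) $ i = h)"
    by (rule exI[of _ h]) (auto simp: xy y_def max_def split: if_splits)
qed

section \<open>Running a policy\<close>

text \<open>A rule sees only the requests so far, so a later request leaves the earlier allocations
  unchanged. This makes induction from the end of the sequence possible.\<close>

lemma run_snoc: "run A (E @ [e]) = run A E @ [A (E @ [e]) (run A E)]"
proof -
  have "run_upto A (E @ [e]) t = run_upto A E t" if "t \<le> length E" for t
    using that by (induction t) auto
  then show ?thesis by (simp add: run_def)
qed

lemma length_run: "length (run A E) = length E"
  by (induction E rule: rev_induct) (simp_all add: run_snoc, simp add: run_def)

lemma request_seq_snoc: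
  "request_seq (E @ [(N, r)]) \<longleftrightarrow> request_seq E \<and> N \<noteq> {} \<and> 0 < r"
  by (auto simp: request_seq_def)

lemma feasible_allocs_run:
  assumes "feasible_rule A" "request_seq E"
  shows "feasible_allocs E (run A E)"
  using assms(2)
proof (induction E rule: rev_induct)
  case (snoc e E)
  obtain N r where e: "e = (N, r)" by force
  have IH: "feasible_allocs E (run A E)"
    using snoc by (simp add: e request_seq_snoc)
  then have "A (E @ [(N, r)]) (run A E) \<in> allocs N r"
    using assms(1) snoc.prems unfolding feasible_rule_def e by blast
  then show ?case
    using IH by (simp add: run_snoc e list_all2_appendI)
qed (simp add: run_def)

lemma feasible_allocs_nth:
  "feasible_allocs E xs \<Longrightarrow> t < length E \<Longrightarrow> xs ! t \<in> allocs (fst (E ! t)) (snd (E ! t))"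
  by (auto dest: list_all2_nthD simp: case_prod_unfold)

lemma feasible_rule_water_filling: "feasible_rule water_filling"
  unfolding feasible_rule_def by (auto simp: request_seq_snoc intro: water_filling_level(1))

lemma water_filling_levels:
  fixes E :: "'n::finite request list"
  assumes "request_seq E"
  defines "xs \<equiv> run water_filling E"
  shows "\<exists>h. \<forall>t<length E. (\<forall>i\<in>fst (E ! t). h t \<le> sum_list (take (Suc t) xs) $ i) \<and>
      (\<forall>i. 0 < xs ! t $ i \<longrightarrow> sum_list (take (Suc t) xs) $ i = h t)"
  using assms(1) unfolding xs_def
proof (induction E rule: rev_induct)
  case (snoc e E)
  obtain N r where e: "e = (N, r)" by force
  let ?l = "run water_filling E" and ?x = "water_filling (E @ [(N, r)]) (run water_filling E)"
  obtain h where h: "\<forall>t<length E. (\<forall>i\<in>fst (E ! t). h t \<le> sum_list (take (Suc t) ?l) $ i) \<and>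
      (\<forall>i. 0 < ?l ! t $ i \<longrightarrow> sum_list (take (Suc t) ?l) $ i = h t)"
    using snoc by (auto simp: e request_seq_snoc)
  obtain g where g: "\<forall>i\<in>N. g \<le> (sum_list ?l + ?x) $ i"
      "\<forall>i. 0 < ?x $ i \<longrightarrow> (sum_list ?l + ?x) $ i = g"
    using water_filling_level(2)[of N r ?l E] snoc.prems by (auto simp: e request_seq_snoc)
  show ?case
    by (rule exI[of _ "h(length E := g)"])
      (use h g in \<open>auto simp: run_snoc e length_run nth_append less_Suc_eq\<close>)
qed simp

section \<open>Expected loads of a randomized policy\<close>

lemma expected_load_Nil: "expected_load M A [] = 0"
  by (simp add: expected_load_def final_load_def run_def)

text \<open>The constraints defining \<open>allocs N r\<close> are linear and survive taking
  expectations. In expectation a randomized policy therefore behaves like a deterministic one, and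
  this is all that the adversary has to know about it.\<close>

lemma expected_load_snoc:
  fixes A :: "'w \<Rightarrow> 'n::finite rule"
  assumes pol: "allocation_policy M A" and seq: "request_seq (E @ [(N, r)])"
  shows "expected_load M A (E @ [(N, r)]) - expected_load M A E \<in> allocs N r"
proof -
  interpret prob_space M using pol by (simp add: allocation_policy_def)
  have run_in: "run (A \<omega>) F ! t \<in> allocs (fst (F ! t)) (snd (F ! t))"
    if "\<omega> \<in> space M" "request_seq F" "t < length F" for \<omega> F t
    using that pol feasible_allocs_nth[OF feasible_allocs_run]
    by (auto simp: allocation_policy_def)
  have int: "integrable M (\<lambda>\<omega>. run (A \<omega>) F ! t)" if "request_seq F" "t < length F" for F t
  \<comment> \<open>The norm of an allocation is at most the sum of its entries, which is the
    requested quantity.\<close>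
  proof (rule integrable_const_bound[of _ "snd (F ! t)"])
    show "(\<lambda>\<omega>. run (A \<omega>) F ! t) \<in> borel_measurable M"
      using pol that by (simp add: allocation_policy_def)
    show "AE \<omega> in M. norm (run (A \<omega>) F ! t) \<le> snd (F ! t)"
    proof (rule AE_I2)
      fix \<omega> assume "\<omega> \<in> space M"
      from run_in[OF this that] show "norm (run (A \<omega>) F ! t) \<le> snd (F ! t)"
        using norm_le_l1_cart[of "run (A \<omega>) F ! t"] by (simp add: allocs_def)
    qed
  qed
  have seqE: "request_seq E" using seq by (simp add: request_seq_snoc)
  let ?F = "E @ [(N, r)]"
  define X where "X \<omega> = run (A \<omega>) ?F ! length E" for \<omega>
  have intX: "integrable M X" unfolding X_def using int[OF seq] by simp
  have inX: "X \<omega> \<in> allocs N r" if "\<omega> \<in> space M" for \<omega>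
    using run_in[OF that seq, of "length E"] by (simp add: X_def)
  have intE: "integrable M (\<lambda>\<omega>. final_load (A \<omega>) E)"
    unfolding final_load_def sum_list_sum_nth length_run
    using int[OF seqE] by (intro Bochner_Integration.integrable_sum) auto
  have "final_load (A \<omega>) ?F = final_load (A \<omega>) E + X \<omega>" for \<omega>
    by (simp add: final_load_def X_def run_snoc length_run nth_append)
  then have "expected_load M A ?F - expected_load M A E = (\<integral>\<omega>. X \<omega> \<partial>M)"
    using intE intX by (simp add: expected_load_def)
  moreover have nth: "(\<integral>\<omega>. X \<omega> \<partial>M) $ i = (\<integral>\<omega>. X \<omega> $ i \<partial>M)" for i
    using integral_bounded_linear[OF bounded_linear_vec_nth intX] by simp
  have "0 \<le> (\<integral>\<omega>. X \<omega> $ i \<partial>M)" for i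
    using inX by (intro integral_nonneg_AE AE_I2) (auto dest: allocs_nonneg)
  moreover have "(\<integral>\<omega>. X \<omega> $ i \<partial>M) = 0" if "i \<notin> N" for i
  proof -
    have "(\<integral>\<omega>. X \<omega> $ i \<partial>M) = (\<integral>\<omega>. 0 \<partial>M)"
      using inX that by (intro Bochner_Integration.integral_cong) (auto simp: allocs_def)
    then show ?thesis by simp
  qed
  moreover have "(\<Sum>i\<in>UNIV. \<integral>\<omega>. X \<omega> $ i \<partial>M) = r"
  proof -
    have "integrable M (\<lambda>\<omega>. X \<omega> $ i)" for i
      using integrable_bounded_linear[OF bounded_linear_vec_nth intX] .
    then have "(\<Sum>i\<in>UNIV. \<integral>\<omega>. X \<omega> $ i \<partial>M) = (\<integral>\<omega>. (\<Sum>i\<in>UNIV. X \<omega> $ i) \<partial>M)"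
      by (intro Bochner_Integration.integral_sum[symmetric])
    also have "\<dots> = (\<integral>\<omega>. r \<partial>M)"
      using inX by (intro Bochner_Integration.integral_cong) (auto simp: allocs_def)
    finally show ?thesis by (simp add: prob_space)
  qed
  ultimately show ?thesis by (simp add: allocs_def nth)
qed

section \<open>The adversary\<close>

text \<open>Greedy choice: each step adds a largest remaining element.\<close>

lemma top_subset_exists:
  fixes y :: "'a \<Rightarrow> real"
  assumes "finite V" "k \<le> card V"
  shows "\<exists>N\<subseteq>V. card N = k \<and> (\<forall>i\<in>N. \<forall>j\<in>V - N. y j \<le> y i)"
  using assms(2)
proof (induction k)
  case 0
  show ?case by (rule exI[of _ "{}"]) simp
next
  case (Suc k)
  then obtain N where N: "N \<subseteq> V" "card N = k" "\<forall>i\<in>N. \<forall>j\<in>V - N. y j \<le> y i" by auto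
  have fin: "finite N" using N(1) assms(1) finite_subset by blast
  have "V - N \<noteq> {}" using N Suc.prems fin by (metis Diff_eq_empty_iff not_less_eq_eq order_refl subset_antisym)
  then have "Max (y ` (V - N)) \<in> y ` (V - N)" using assms(1) by (intro Max_in) auto
  then obtain a where a: "a \<in> V - N" "y a = Max (y ` (V - N))" by force
  then have "\<forall>j\<in>V - N. y j \<le> y a" using assms(1) by simp
  note a = a(1) this
  show ?case
    by (rule exI[of _ "insert a N"]) (use N a fin in auto)
qed

text \<open>The average over the smallest elements is at most the average over all, with
  denominators cleared so that empty sets need no care. It follows by summing
  \<open>z i \<le> z j\<close> over all pairs from \<open>W\<close> and
  \<open>V - W\<close>.\<close>

lemma card_mult_sum_le:
  fixes z :: "'a \<Rightarrow> real"
  assumes "finite V" "W \<subseteq> V" "\<And>i j. i \<in> W \<Longrightarrow> j \<in> V - W \<Longrightarrow> z i \<le> z j"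
  shows "real (card V) * sum z W \<le> real (card W) * sum z V"
proof -
  have fin: "finite W" using assms finite_subset by blast
  have "real (card (V - W)) * sum z W = (\<Sum>i\<in>W. \<Sum>j\<in>V - W. z i)"
    by (simp add: sum_distrib_left)
  also have "\<dots> \<le> (\<Sum>i\<in>W. \<Sum>j\<in>V - W. z j)"
    using assms(3) by (intro sum_mono) auto
  also have "\<dots> = real (card W) * sum z (V - W)" by simp
  finally have "real (card (V - W)) * sum z W \<le> real (card W) * sum z (V - W)" .
  moreover have "card (V - W) + card W = card V"
    using assms fin by (metis card_Diff_subset card_mono le_add_diff_inverse2)
  then have "real (card V) = real (card (V - W)) + real (card W)" by linarith
  moreover have "sum z V = sum z (V - W) + sum z W"
    using assms fin by (metis sum.subset_diff)
  ultimately show ?thesis by (simp add: algebra_simps)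
qed

text \<open>Each neighborhood of the new sequence consists of the currently most loaded nodes of the
  previous one, so passing to it cannot lower the average load, whereas the average of the partial
  sums of \<open>xs\<close> cannot increase.\<close>

lemma adversarial_nested_seq:
  fixes E :: "'n::finite request list" and f :: "'n request list \<Rightarrow> real ^ 'n"
  assumes f: "f [] = 0" "\<And>E N r. request_seq (E @ [(N, r)]) \<Longrightarrow> f (E @ [(N, r)]) - f E \<in> allocs N r"
    and "request_seq E" "sorted_wrt (\<supseteq>) (map fst E)" "feasible_allocs E xs"
    and "\<And>k i j. Suc k < length E \<Longrightarrow> i \<in> fst (E ! Suc k) \<Longrightarrow> j \<in> fst (E ! k) - fst (E ! Suc k) \<Longrightarrow>
      sum_list (take (Suc k) xs) $ i \<le> sum_list (take (Suc k) xs) $ j"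
  shows "\<exists>E'. request_seq E' \<and> sorted_wrt (\<supseteq>) (map fst E') \<and>
    list_all2 (\<lambda>(N, r) (N', r'). card N = card N' \<and> r = r') E E' \<and>
    (\<forall>t<length E. (\<Sum>i\<in>fst (E ! t). sum_list xs $ i) \<le> (\<Sum>i\<in>fst (E' ! t). f E' $ i))"
  using assms(3-)
proof (induction E arbitrary: xs rule: rev_induct)
  case Nil
  then show ?case by (intro exI[of _ "[]"]) (simp add: request_seq_def)
next
  case (snoc e E)
  obtain W r where e: "e = (W, r)" by force
  obtain zs x where xs: "xs = zs @ [x]" "feasible_allocs E zs" "x \<in> allocs W r"
    using snoc.prems(3) by (auto simp: e list_all2_append1 list_all2_Cons1)
  have len: "length zs = length E" using xs(2) by (simp add: list_all2_lengthD)
  have W: "W \<noteq> {}" "0 < r" "\<And>V. V \<in> set (map fst E) \<Longrightarrow> W \<subseteq> V"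
    using snoc.prems(1,2) by (auto simp: e request_seq_snoc sorted_wrt_append)
  have ord: "sum_list (take (Suc k) zs) $ i \<le> sum_list (take (Suc k) zs) $ j"
    if "Suc k < length E" "i \<in> fst (E ! Suc k)" "j \<in> fst (E ! k) - fst (E ! Suc k)" for k i j
    using snoc.prems(4)[of k i j] that by (simp add: nth_append xs len)
  obtain E' where E': "request_seq E'" "sorted_wrt (\<supseteq>) (map fst E')"
    "list_all2 (\<lambda>(N, r) (N', r'). card N = card N' \<and> r = r') E E'"
    "\<forall>t<length E. (\<Sum>i\<in>fst (E ! t). sum_list zs $ i) \<le> (\<Sum>i\<in>fst (E' ! t). f E' $ i)"
    using snoc.IH[OF _ _ xs(2) ord] snoc.prems(1,2)
    by (auto simp: e request_seq_snoc sorted_wrt_append)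
  have len': "length E' = length E" using E'(3) by (simp add: list_all2_lengthD)
  \<comment> \<open>\<open>V\<close> and \<open>V'\<close> are the last neighborhoods of
    \<open>E\<close> and \<open>E'\<close>. If there are none yet, the set of all nodes takes their
    place, and both loads are 0.\<close>
  obtain V V' where V: "card V = card V'" "W \<subseteq> V" "\<And>U. U \<in> set (map fst E') \<Longrightarrow> V' \<subseteq> U"
    "(\<Sum>i\<in>V. sum_list zs $ i) \<le> (\<Sum>i\<in>V'. f E' $ i)"
    "\<And>i j. i \<in> W \<Longrightarrow> j \<in> V - W \<Longrightarrow> sum_list zs $ i \<le> sum_list zs $ j"
  proof (cases "E = []")
    case True
    then show ?thesis using that[of UNIV UNIV] len len' f(1) by simp
  next
    case False
    define k where "k = length E - 1"
    have k: "Suc k = length E" using False by (simp add: k_def)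
    show ?thesis
    proof (rule that[of "fst (E ! k)" "fst (E' ! k)"])
      show "card (fst (E ! k)) = card (fst (E' ! k))"
        using list_all2_nthD[OF E'(3), of k] k by (auto simp: case_prod_unfold)
      show "W \<subseteq> fst (E ! k)" using W(3) k by auto
      show "fst (E' ! k) \<subseteq> U" if U: "U \<in> set (map fst E')" for U
      proof -
        obtain t where "t < length E'" "U = fst (E' ! t)"
          using U by (auto simp: in_set_conv_nth)
        moreover have "t < k \<or> t = k" using calculation k len' by auto
        ultimately show ?thesis
          using sorted_wrt_nth_less[OF E'(2), of t k] k len' by auto
      qed
      show "(\<Sum>i\<in>fst (E ! k). sum_list zs $ i) \<le> (\<Sum>i\<in>fst (E' ! k). f E' $ i)"
        using E'(4) k by auto
      fix i j assume "i \<in> W" "j \<in> fst (E ! k) - W"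
      then show "sum_list zs $ i \<le> sum_list zs $ j"
        using snoc.prems(4)[of k i j] k by (simp add: nth_append e xs len)
    qed
  qed
  have "card W \<le> card V'" using V(1,2) by (metis card_mono finite)
  then obtain N where N: "N \<subseteq> V'" "card N = card W" "\<forall>i\<in>N. \<forall>j\<in>V' - N. f E' $ j \<le> f E' $ i"
    using top_subset_exists[of V' "card W" "($) (f E')"] by auto
  \<comment> \<open>Chain of averages: \<open>W\<close> holds the least loaded nodes of
    \<open>V\<close>, and \<open>N\<close> the most loaded nodes of \<open>V'\<close>.\<close>
  have "real (card V) * (\<Sum>i\<in>W. sum_list zs $ i) \<le> real (card W) * (\<Sum>i\<in>V. sum_list zs $ i)"
    using V by (intro card_mult_sum_le) auto
  also have "\<dots> \<le> real (card N) * (\<Sum>i\<in>V'. f E' $ i)"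
    using V(4) by (simp add: N(2) mult_left_mono)
  also have "\<dots> \<le> real (card V') * (\<Sum>i\<in>N. f E' $ i)"
    using card_mult_sum_le[of V' N "\<lambda>i. - (f E' $ i)"] N by (simp add: sum_negf)
  finally have "real (card V) * (\<Sum>i\<in>W. sum_list zs $ i) \<le> real (card V) * (\<Sum>i\<in>N. f E' $ i)"
    by (simp add: V(1))
  moreover have "0 < card V" using W(1) V(2) by (auto simp: card_gt_0_iff)
  ultimately have base: "(\<Sum>i\<in>W. sum_list zs $ i) \<le> (\<Sum>i\<in>N. f E' $ i)" by simp
  have "N \<noteq> {}" using N(2) W(1) by (metis card_eq_0_iff finite)
  let ?E' = "E' @ [(N, r)]"
  have seq': "request_seq ?E'" using E'(1) \<open>N \<noteq> {}\<close> W by (simp add: request_seq_snoc)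
  define x' where "x' = f ?E' - f E'"
  have x': "x' \<in> allocs N r" "f ?E' = f E' + x'"
    using f(2)[OF seq'] by (simp_all add: x'_def)
  have sub: "N \<subseteq> U" if "U \<in> set (map fst E')" for U
    using N(1) V(3)[OF that] by blast
  \<comment> \<open>By nesting, the whole quantity \<open>r\<close> falls into every earlier
    neighborhood on either side, so old inequalities persist.\<close>
  have add_r: "(\<Sum>i\<in>S. sum_list xs $ i) \<le> (\<Sum>i\<in>S'. f ?E' $ i)"
    if "W \<subseteq> S" "N \<subseteq> S'" "(\<Sum>i\<in>S. sum_list zs $ i) \<le> (\<Sum>i\<in>S'. f E' $ i)" for S S'
    using that sum_allocs[OF xs(3) that(1)] sum_allocs[OF x'(1) that(2)]
    by (simp add: xs(1) x'(2) sum.distrib)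
  show ?case
  proof (intro exI[of _ ?E'] conjI allI impI seq')
    show "sorted_wrt (\<supseteq>) (map fst ?E')"
      using E'(2) sub by (auto simp: sorted_wrt_append)
    show "list_all2 (\<lambda>(N, r) (N', r'). card N = card N' \<and> r = r') (E @ [e]) ?E'"
      using E'(3) N(2) by (simp add: e list_all2_appendI)
    fix t assume t: "t < length (E @ [e])"
    show "(\<Sum>i\<in>fst ((E @ [e]) ! t). sum_list xs $ i) \<le> (\<Sum>i\<in>fst (?E' ! t). f ?E' $ i)"
    proof (cases "t < length E")
      case True
      have "W \<subseteq> fst (E ! t)" using W(3) True by simp
      moreover have "N \<subseteq> fst (E' ! t)" using sub True len' by simp
      ultimately show ?thesis
        using add_r E'(4) True len' by (simp add: nth_append)
    next
      case False
      then have "t = length E" using t by simp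
      then show ?thesis using add_r[OF _ _ base] len' by (simp add: nth_append e)
    qed
  qed
qed

lemma expected_load_total:
  assumes "allocation_policy M A" "request_seq E"
  shows "(\<Sum>i\<in>UNIV. expected_load M A E $ i) = sum_list (map snd E)"
  using assms(2)
proof (induction E rule: rev_induct)
  case (snoc e E)
  obtain N r where e: "e = (N, r)" by force
  have "(\<Sum>i\<in>UNIV. (expected_load M A (E @ [e]) - expected_load M A E) $ i) = r"
    using expected_load_snoc[OF assms(1)] snoc.prems unfolding e by (intro sum_allocs) auto
  then show ?case
    using snoc by (simp add: e request_seq_snoc sum_subtractf)
qed (simp add: expected_load_Nil)

section \<open>The nested sequence obtained from a run of water-filling\<close>

lemma sum_list_map_nth_vec:
  fixes xs :: "(real ^ 'n::finite) list"
  assumes "distinct ts"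
  shows "sum_list (map ((!) xs) ts) $ i = (\<Sum>t\<in>set ts. xs ! t $ i)"
  using assms by (simp add: sum_list_distinct_conv_sum_set)

text \<open>The requests are sorted by their water levels \<open>h\<close>, and the neighborhood of request \<open>t\<close> is
  enlarged to the set of nodes with final load at least \<open>h t\<close>.\<close>

lemma water_filling_nested:
  fixes E :: "'n::finite request list"
  assumes seq: "request_seq E"
  obtains E' xs where "request_seq E'" "length E' = length E"
    "sum_list (map snd E') = sum_list (map snd E)"
    "sorted_wrt (\<supseteq>) (map fst E')" "feasible_loads E \<subseteq> feasible_loads E'"
    "feasible_allocs E' xs" "sum_list xs = WF E"
    "\<And>k i j. Suc k < length E' \<Longrightarrow> i \<in> fst (E' ! Suc k) \<Longrightarrow> j \<in> fst (E' ! k) - fst (E' ! Suc k) \<Longrightarrow>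
      sum_list (take (Suc k) xs) $ i \<le> sum_list (take (Suc k) xs) $ j"
    "\<And>c. 0 \<le> c \<Longrightarrow> {i. c < WF E $ i} \<noteq> {} \<Longrightarrow> \<exists>t<length E'. {i. c < WF E $ i} = fst (E' ! t)"
proof -
  define ws where "ws = run water_filling E"
  define w where "w = WF E"
  have w: "w = sum_list ws" by (simp add: w_def WF_def final_load_def ws_def)
  have len: "length ws = length E" by (simp add: ws_def length_run)
  have feas: "feasible_allocs E ws"
    unfolding ws_def using feasible_rule_water_filling seq by (rule feasible_allocs_run)
  have nonneg: "0 \<le> ws ! t $ i" if "t < length E" for t i
    using feasible_allocs_nth[OF feas that] by (rule allocs_nonneg)
  have partial: "sum_list (take k ws) $ i = (\<Sum>t<k. ws ! t $ i)" if "k \<le> length E" for k i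
    using that by (simp add: sum_list_vec_nth len)
  have w_nth: "w $ i = (\<Sum>t<length E. ws ! t $ i)" for i
    by (simp add: w sum_list_vec_nth len)
  have partial_le: "sum_list (take k ws) $ i \<le> w $ i" if "k \<le> length E" for k i
    unfolding partial[OF that] w_nth using that nonneg by (intro sum_mono2) auto
  obtain h where "\<forall>t<length E. (\<forall>i\<in>fst (E ! t). h t \<le> sum_list (take (Suc t) ws) $ i) \<and>
      (\<forall>i. 0 < ws ! t $ i \<longrightarrow> sum_list (take (Suc t) ws) $ i = h t)"
    using water_filling_levels[OF seq] unfolding ws_def by blast
  then have h: "\<And>t i. t < length E \<Longrightarrow> i \<in> fst (E ! t) \<Longrightarrow> h t \<le> sum_list (take (Suc t) ws) $ i"
      "\<And>t i. t < length E \<Longrightarrow> 0 < ws ! t $ i \<Longrightarrow> sum_list (take (Suc t) ws) $ i = h t"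
    by auto
  have h_le: "h t \<le> w $ i" if "t < length E" "i \<in> fst (E ! t) \<or> 0 < ws ! t $ i" for t i
    using h[OF that(1), of i] that partial_le[of "Suc t" i] by force
  \<comment> \<open>The last request of \<open>T\<close> that serves \<open>i\<close> leaves it at
    its own level, which is at most \<open>c\<close> and already counts all earlier contributions.
    The condition \<open>0 \<le> c\<close> covers the case that no request of \<open>T\<close>
    serves \<open>i\<close>.\<close>
  have sum_le: "(\<Sum>t\<in>T. ws ! t $ i) \<le> c"
    if T: "T \<subseteq> {..<length E}" "\<And>t. t \<in> T \<Longrightarrow> h t \<le> c" "0 \<le> c" for T i c
  proof -
    define P where "P = {t \<in> T. 0 < ws ! t $ i}"
    have fin: "finite T" using T(1) finite_subset by blast
    have eq: "(\<Sum>t\<in>T. ws ! t $ i) = (\<Sum>t\<in>P. ws ! t $ i)"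
      using fin T(1) nonneg unfolding P_def
      by (intro sum.mono_neutral_right) (auto simp: less_le)
    show ?thesis
    proof (cases "P = {}")
      case True
      then show ?thesis using T(3) by (simp add: eq)
    next
      case False
      have finP: "finite P" using fin by (simp add: P_def)
      let ?t = "Max P"
      have tP: "?t \<in> P" using finP False by (rule Max_in)
      then have t: "?t \<in> T" "?t < length E" "0 < ws ! ?t $ i" using T(1) by (auto simp: P_def)
      have "P \<subseteq> {..<Suc ?t}" using finP by (auto simp: less_Suc_eq_le)
      then have "(\<Sum>t\<in>P. ws ! t $ i) \<le> (\<Sum>t<Suc ?t. ws ! t $ i)"
        using nonneg t(2) by (intro sum_mono2) auto
      also have "\<dots> = h ?t" using h(2)[OF t(2,3)] partial[of "Suc ?t" i] t(2) by simp
      finally show ?thesis using T(2)[OF t(1)] eq by simp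
    qed
  qed
  \<comment> \<open>The final load of \<open>i\<close> is the level of the last request that serves
    it.\<close>
  have level: "\<exists>t<length E. h t = w $ i" if "0 < w $ i" for i
  proof -
    define P where "P = {t. t < length E \<and> 0 < ws ! t $ i}"
    have "P \<noteq> {}"
    proof
      assume "P = {}"
      then have "ws ! t $ i \<le> 0" if "t < length E" for t
        using that by (auto simp: P_def not_less dest: spec[of _ t])
      then have "w $ i \<le> 0"
        unfolding w_nth by (intro sum_nonpos) auto
      then show False using that by simp
    qed
    moreover have finP: "finite P" by (simp add: P_def)
    ultimately have "Max P \<in> P" by simp
    then have t: "Max P < length E" "0 < ws ! Max P $ i" by (auto simp: P_def)
    have "ws ! t $ i = 0" if "t < length E" "\<not> t < Suc (Max P)" for t
    proof -
      have "t \<notin> P" using Max_ge[OF finP, of t] that(2) by auto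
      then show ?thesis using nonneg[OF that(1), of i] that(1) by (auto simp: P_def)
    qed
    then have "w $ i = (\<Sum>t<Suc (Max P). ws ! t $ i)"
      unfolding w_nth using t(1) by (intro sum.mono_neutral_right) auto
    then show ?thesis
      using h(2)[OF t] partial[of "Suc (Max P)" i] t(1) by auto
  qed
  have w_nonneg: "0 \<le> w $ i" for i
    unfolding w_nth using nonneg by (intro sum_nonneg) auto

  define ts where "ts = sort_key h [0..<length E]"
  have ts: "distinct ts" "set ts = {..<length E}" "length ts = length E" "sorted (map h ts)"
    by (auto simp: ts_def)
  have ts_lt: "ts ! k < length E" if "k < length E" for k
    using ts(2,3) that nth_mem[of k ts] by auto
  have h_mono: "h (ts ! k) \<le> h (ts ! k')" if "k \<le> k'" "k' < length E" for k k'
    using sorted_nth_mono[OF ts(4) that(1)] that ts(3) by simp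
  define W where "W t = {i. h t \<le> w $ i}" for t
  have N_W: "fst (E ! t) \<subseteq> W t" if "t < length E" for t
    using h_le[OF that] by (auto simp: W_def)
  define E' where "E' = map (\<lambda>t. (W t, snd (E ! t))) ts"
  have E'_nth: "E' ! k = (W (ts ! k), snd (E ! (ts ! k)))" if "k < length E" for k
    using that ts(3) by (simp add: E'_def)
  have lenE': "length E' = length E" by (simp add: E'_def ts(3))
  \<comment> \<open>Stated for arbitrary \<open>ys\<close>: it serves both the inclusion of the
    feasible loads and the water-filling allocations \<open>ws\<close>.\<close>
  have feas': "feasible_allocs E' (map ((!) ys) ts)" if "feasible_allocs E ys" for ys
    unfolding list_all2_conv_all_nth
  proof (intro conjI allI impI)
    fix k assume "k < length E'"
    then have k: "k < length E" by (simp add: lenE')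
    have "ys ! (ts ! k) \<in> allocs (W (ts ! k)) (snd (E ! (ts ! k)))"
      using feasible_allocs_nth[OF that ts_lt[OF k]] allocs_mono[OF N_W[OF ts_lt[OF k]]] by blast
    then show "(case E' ! k of (N, r) \<Rightarrow> \<lambda>x. x \<in> allocs N r) (map ((!) ys) ts ! k)"
      using k ts(3) by (simp add: E'_nth)
  qed (simp add: E'_def)
  have sum_ts: "sum_list (map ((!) ys) ts) = sum_list ys" if "length ys = length E"
    for ys :: "(real ^ 'n) list"
    proof -
    have "sum_list (map ((!) ys) ts) = (\<Sum>t<length E. ys ! t)"
      using ts(1,2) by (simp add: sum_list_distinct_conv_sum_set)
    then show ?thesis using that by (simp add: sum_list_sum_nth atLeast0LessThan)
  qed
  have E_nth: "fst (E ! t) \<noteq> {} \<and> 0 < snd (E ! t)" if "t < length E" for t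
    using seq nth_mem[OF that] by (auto simp: request_seq_def case_prod_unfold)
  show thesis
  proof (rule that)
    show "request_seq E'"
      using E_nth N_W ts(2) by (fastforce simp: E'_def request_seq_def)
    have "map snd E' = map (\<lambda>t. snd (E ! t)) ts" by (simp add: E'_def)
    then have "sum_list (map snd E') = (\<Sum>t<length E. snd (E ! t))"
      using ts(1,2) by (simp add: sum_list_distinct_conv_sum_set)
    then show "sum_list (map snd E') = sum_list (map snd E)"
      by (simp add: sum_list_sum_nth atLeast0LessThan)
    have "sorted_wrt (\<lambda>t t'. h t \<le> h t') ts"
      using ts(4) by (simp add: sorted_map)
    then show "sorted_wrt (\<supseteq>) (map fst E')"
      unfolding E'_def sorted_wrt_map
      by (rule sorted_wrt_mono_rel[rotated]) (auto simp: W_def)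
    show "feasible_loads E \<subseteq> feasible_loads E'"
    proof
      fix l assume "l \<in> feasible_loads E"
      then obtain ys where "feasible_allocs E ys" "l = sum_list ys" by (auto simp: feasible_loads_iff)
      then show "l \<in> feasible_loads E'"
        using feas' sum_ts by (metis feasible_loads_iff list_all2_lengthD)
    qed
    show "feasible_allocs E' (map ((!) ws) ts)" using feas by (rule feas')
    show "sum_list (map ((!) ws) ts) = WF E" using sum_ts[OF len] w w_def by simp
    show "length E' = length E" by (rule lenE')
  next
    fix k i j
    assume k: "Suc k < length E'" and i: "i \<in> fst (E' ! Suc k)"
      and j: "j \<in> fst (E' ! k) - fst (E' ! Suc k)"
    have k': "k < length E" "Suc k < length E" using k lenE' by auto
    \<comment> \<open>A dropped node \<open>j\<close> has its final load between two consecutive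
      levels. The first \<open>Suc k\<close> requests have levels at most \<open>w $ j\<close>, so
      they give \<open>i\<close> at most \<open>w $ j\<close> by \<open>sum_le\<close>.\<close>
    have hj: "h (ts ! k) \<le> w $ j" "w $ j < h (ts ! Suc k)"
      using j k' by (auto simp: E'_nth W_def)
    let ?T = "set (take (Suc k) ts)"
    have sub: "?T \<subseteq> {..<length E}" using ts(2) set_take_subset by fastforce
    have eq: "sum_list (take (Suc k) (map ((!) ws) ts)) $ a = (\<Sum>t\<in>?T. ws ! t $ a)" for a
      using ts(1) by (simp only: take_map) (intro sum_list_map_nth_vec distinct_take)
    have "(\<Sum>t\<in>?T. ws ! t $ i) \<le> w $ j"
    proof (rule sum_le[OF sub _ w_nonneg])
      fix t assume "t \<in> ?T"
      then obtain p where "p < Suc k" "t = ts ! p"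
        by (auto simp: in_set_conv_nth)
      then show "h t \<le> w $ j" using h_mono[of p k] k' hj(1) by simp
    qed
    \<comment> \<open>The remaining requests have levels above \<open>w $ j\<close> and cannot serve
      \<open>j\<close>, so \<open>j\<close> already carries its final load.\<close>
    also have "w $ j = (\<Sum>t\<in>?T. ws ! t $ j)"
      unfolding w_nth
    proof (intro sum.mono_neutral_right ballI sub)
      fix t assume t: "t \<in> {..<length E} - ?T"
      then obtain p where p: "p < length E" "t = ts ! p"
        using ts(2,3) by (metis DiffD1 in_set_conv_nth)
      have "\<not> p < Suc k"
      proof
        assume "p < Suc k"
        then have "t \<in> ?T" using p ts(3) by (auto simp: in_set_conv_nth intro!: exI[of _ p])
        then show False using t by simp
      qed
      then have "w $ j < h t" using h_mono[of "Suc k" p] p hj(2) by simp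
      then have "\<not> 0 < ws ! t $ j" using h_le[of t j] t by auto
      then show "ws ! t $ j = 0" using nonneg[of t j] t by auto
    qed simp
    finally show "sum_list (take (Suc k) (map ((!) ws) ts)) $ i
        \<le> sum_list (take (Suc k) (map ((!) ws) ts)) $ j" by (simp only: eq)
  next
    fix c :: real assume c: "0 \<le> c" "{i. c < WF E $ i} \<noteq> {}"
    let ?U = "{i. c < w $ i}"
    \<comment> \<open>The least final load above \<open>c\<close> is positive, hence a water level,
      and its level set is exactly \<open>?U\<close>.\<close>
    have "Min (($) w ` ?U) \<in> ($) w ` ?U"
      using c(2) by (intro Min_in) (auto simp: w_def)
    then obtain i where i: "c < w $ i" "Min (($) w ` ?U) = w $ i" by auto
    have least: "w $ i \<le> w $ k" if "c < w $ k" for k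
      unfolding i(2)[symmetric] using that by (intro Min_le) auto
    obtain t where t: "t < length E" "h t = w $ i" using level[of i] i(1) c(1) by auto
    obtain p where p: "p < length E" "t = ts ! p"
      using t ts(2,3) by (metis in_set_conv_nth lessThan_iff)
    have "?U = W t" using least i(1) by (auto simp: W_def t(2))
    also have "\<dots> = fst (E' ! p)" using p by (simp add: E'_nth)
    finally show "\<exists>t<length E'. {i. c < WF E $ i} = fst (E' ! t)"
      using p(1) lenE' unfolding w_def by metis
  qed
qed

theorem theorem1:
  fixes m :: nat and q :: real
    and M :: "'w measure" and A :: "'w \<Rightarrow> 'n::finite rule" and E :: "'n request list"
  assumes "q > 0"
    and "allocation_policy M A"
    and "E \<in> request_seqs m q"
  shows "\<exists>E' \<in> nested_request_seqs m q.
           expected_load M A E' majorizes WF E \<and> OPT E majorizes OPT E'"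
proof -
  have E: "request_seq E" "length E = m" "sum_list (map snd E) = q"
    using assms(3) by (auto simp: request_seqs_def)
  obtain F xs where F: "request_seq F" "length F = length E"
    "sum_list (map snd F) = sum_list (map snd E)"
    "sorted_wrt (\<supseteq>) (map fst F)" "feasible_loads E \<subseteq> feasible_loads F"
    "feasible_allocs F xs" "sum_list xs = WF E"
    "\<And>k i j. Suc k < length F \<Longrightarrow> i \<in> fst (F ! Suc k) \<Longrightarrow> j \<in> fst (F ! k) - fst (F ! Suc k) \<Longrightarrow>
      sum_list (take (Suc k) xs) $ i \<le> sum_list (take (Suc k) xs) $ j"
    "\<And>c. 0 \<le> c \<Longrightarrow> {i. c < WF E $ i} \<noteq> {} \<Longrightarrow> \<exists>t<length F. {i. c < WF E $ i} = fst (F ! t)"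
    using water_filling_nested[OF E(1)] by blast
  obtain E' where E': "request_seq E'" "sorted_wrt (\<supseteq>) (map fst E')"
    "list_all2 (\<lambda>(N, r) (N', r'). card N = card N' \<and> r = r') F E'"
    "\<forall>t<length F. (\<Sum>i\<in>fst (F ! t). WF E $ i) \<le> (\<Sum>i\<in>fst (E' ! t). expected_load M A E' $ i)"
    using adversarial_nested_seq[of "expected_load M A" F xs, OF expected_load_Nil
        expected_load_snoc[OF assms(2)] F(1,4,6,8)] unfolding F(7) by blast
  have len: "length E' = length F" using E'(3) by (simp add: list_all2_lengthD)
  have "map snd F = map snd E'"
    using E'(3) len by (auto simp: list_all2_conv_all_nth case_prod_unfold intro!: nth_equalityI)
  then have q: "sum_list (map snd E') = q" using F(3) E(3) by simp
  show ?thesis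
  proof (intro bexI conjI)
    show "E' \<in> nested_request_seqs m q"
      using E' E F(2) len q by (simp add: nested_request_seqs_def request_seqs_def)
    \<comment> \<open>Feasibility of \<open>OPT E\<close> for \<open>F\<close> suffices; it need not
      be the optimum there.\<close>
    have "OPT E \<in> feasible_loads F" using OPT_least(1)[OF E(1)] F(5) by blast
    then show "OPT E majorizes OPT E'"
      using OPT_majorizes_OPT_same_cards[OF E'(1) _ F(4) E'(2,3)] by blast
    have WF_feasible: "WF E \<in> feasible_loads F"
      using F(6,7) by (metis feasible_loads_iff)
    have total: "(\<Sum>i\<in>UNIV. expected_load M A E' $ i) = (\<Sum>i\<in>UNIV. WF E $ i)"
      using expected_load_total[OF assms(2) E'(1)] sum_feasible_load[OF WF_feasible] q F(3) E(3)
      by simp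
    show "expected_load M A E' majorizes WF E"
    proof (rule majorizesI[OF total])
      fix c
      let ?U = "{i. c < WF E $ i}"
      show "\<exists>S. card S = card ?U \<and> (\<Sum>i\<in>?U. WF E $ i) \<le> (\<Sum>i\<in>S. expected_load M A E' $ i)"
      \<comment> \<open>In the main case \<open>?U\<close> is a neighborhood of \<open>F\<close>,
        and the neighborhood of \<open>E'\<close> at the same index is the required set. For
        negative \<open>c\<close> the level set contains all nodes, and the equality of the totals
        settles the claim.\<close>
      proof (cases "0 \<le> c \<and> ?U \<noteq> {}")
        case True
        then obtain t where t: "t < length F" "?U = fst (F ! t)" using F(9) by blast
        have "card (fst (E' ! t)) = card ?U"
          using list_all2_nthD[OF E'(3) t(1)] t(2) by (auto simp: case_prod_unfold)
        then show ?thesis using E'(4) t by auto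
      next
        case False
        have "0 \<le> WF E $ i" for i
          unfolding F(7)[symmetric] sum_list_vec_nth
          using allocs_nonneg[OF feasible_allocs_nth[OF F(6)]] list_all2_lengthD[OF F(6)]
          by (intro sum_nonneg) auto
        then have "c < WF E $ i" if "c < 0" for i
          using that by (rule less_le_trans[rotated])
        then have "?U = {} \<or> ?U = UNIV"
          using False by (cases "c < 0") auto
        then show ?thesis using total by (metis order_refl sum.empty)
      qed
    qed
  qed
qed

end
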